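(* Let $\lambda_{BS}>0$, $p\in(0,1)$, $P_{macro},P_{micro}>0$, $\beta>2$, $\lambda_{SU}>0$. Let $\Phi_{macro},\Phi_{micro}$ be independent homogeneous Poisson point processes on $\mathbb{R}^2$ of intensities $p\lambda_{BS}$ and $(1-p)\lambda_{BS}$, and $\mathcal{U}_{static}$ an independent homogeneous Poisson point process of intensity $\lambda_{SU}$. Let $X^*$ be the point of $\Phi_{macro}$ closest to the origin, $V_{het}(X^* )$ its hetnet cell and $C_0$ the hetnet cell containing the origin. Under the Palm distribution $\mathbf{E}^0_{macro}$ (resp. $\mathbf{E}^0_{micro}$), obtained by adding a macro (resp. micro) station at the origin, let $V_{het}(0)$ be the hetnet cell of the station at the origin. Define $$\hat N_{SU,het}=1+\mathbf{P}\{C_0=V_{het}(X^* )\}\,\mathbf{E}^0_{macro}[|\mathcal{U}_{static}(V_{het}(0))|]+\mathbf{P}\{C_0\neq V_{het}(X^* )\}\,\mathbf{E}^0_{micro}[|\mathcal{U}_{static}(V_{het}(0))|].$$ Then $$\hat N_{SU,het}=1+\Big(\frac{pP_{macro}^{2/\beta}}{pP_{macro}^{2/\beta}+(1-p)P_{micro}^{2/\beta}}\Big)^2\frac{\lambda_{SU}}{\lambda_{BS}p}+\Big(\frac{(1-p)P_{micro}^{2/\beta}}{pP_{macro}^{2/\beta}+(1-p)P_{micro}^{2/\beta}}\Big)^2\frac{\lambda_{SU}}{\lambda_{BS}(1-p)}.$$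
   Context: With $\Phi=\Phi_{macro}\cup\Phi_{micro}$ and $P_i=P_{macro}$ for macro stations, $P_i=P_{micro}$ for micro stations, the hetnet cell of a station $X_i\in\Phi$ is the set of $z\in\mathbb{R}^2$ with $P_i|X_i-z|^{-\beta}\ge P_j|X_j-z|^{-\beta}$ for all $X_j\in\Phi$. $|\mathcal{U}_{static}(B)|$ is the number of static users in $B$. *)

theory Defs
  imports "HOL-Probability.Probability"
begin

type_synonym pt = "real ^ 2"

definition hppp :: "'a measure \<Rightarrow> ('a \<Rightarrow> pt set) \<Rightarrow> real \<Rightarrow> bool" where
  "hppp M N lam \<longleftrightarrow>
     (\<forall>\<omega>\<in>space M. \<forall>B. bounded B \<longrightarrow> finite (N \<omega> \<inter> B)) \<and>
     (\<forall>B. B \<in> sets lborel \<and> bounded B \<longrightarrow>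
        (\<forall>k::nat. measure M {\<omega>\<in>space M. card (N \<omega> \<inter> B) = k}
             = exp (- (lam * measure lborel B)) * (lam * measure lborel B) ^ k / fact k)) \<and>
     (\<forall>Bs :: nat \<Rightarrow> pt set. (\<forall>i. Bs i \<in> sets lborel \<and> bounded (Bs i)) \<and> disjoint_family Bs \<longrightarrow>
        prob_space.indep_vars M (\<lambda>_. count_space UNIV) (\<lambda>i \<omega>. card (N \<omega> \<inter> Bs i)) UNIV)"

definition count_sigma :: "'a measure \<Rightarrow> ('a \<Rightarrow> pt set) \<Rightarrow> 'a set set" where
  "count_sigma M N = sigma_sets (space M)
     {{\<omega>\<in>space M. card (N \<omega> \<inter> B) = k} | B k. B \<in> sets lborel \<and> bounded B}"

definition stations :: "real \<Rightarrow> real \<Rightarrow> pt set \<Rightarrow> pt set \<Rightarrow> (pt \<times> real) set" where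
  "stations Pmac Pmic Mac Mic = (\<lambda>x. (x, Pmac)) ` Mac \<union> (\<lambda>x. (x, Pmic)) ` Mic"

text \<open>Hetnet cell of station X with power Pi: the points z with
  Pi |X-z|^(-beta) >= Pj |Y-z|^(-beta) for all stations (Y,Pj); written with the
  denominators cleared (convention |0|^(-beta) = infinity).\<close>
definition het_cell :: "real \<Rightarrow> (pt \<times> real) set \<Rightarrow> pt \<Rightarrow> real \<Rightarrow> pt set" where
  "het_cell \<beta> S X Pw = {z. \<forall>(Y, Pj)\<in>S. Pj * dist X z powr \<beta> \<le> Pw * dist Y z powr \<beta>}"

definition is_closest :: "pt set \<Rightarrow> pt \<Rightarrow> bool" where
  "is_closest \<Phi> x \<longleftrightarrow> x \<in> \<Phi> \<and> (\<forall>y\<in>\<Phi>. norm x \<le> norm y)"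

end

(* The origin's cell contains z iff the stations avoid two explicit balls around z, so for
   each fixed z this has probability exp (- k |z|^2). Averaging the independent users over
   the random cell (a Campbell formula) turns the mean number of users into the user
   intensity times the Gaussian integral pi / k. As cells are only known pointwise, the
   Campbell formula is obtained from finite sums over a dyadic grid. For the probability that
   the nearest macro station serves the origin, the areas of the largest discs around the
   origin void of macro, respectively micro, stations are independent exponential variables. *)
theory Submission
  imports Defs
begin

text \<open>The hypotheses speak only of counts in fixed bounded Borel sets and of independence
  between the sigma-algebras that these counts generate. Joint measurability of
  \<open>z \<in> V \<omega>\<close> in \<open>\<omega>\<close> and \<open>z\<close> is not given, so
  Fubini cannot be applied to the cell directly. Once \<open>z\<close> is rounded to a dyadic point,
  membership is constant on each dyadic cube, and the mean count is a finite sum of products of a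
  station event and a user count, to which independence applies; the limit recovers the true cell.
  The squares in the result arise because one fraction occurs twice. With tier weights a = p
  Pmac^(2/beta) and b = (1 - p) Pmic^(2/beta), the nearest macro station serves the origin with
  probability a / (a + b), and a macro cell has mean user count a / (a + b) times lamSU / (lamBS p).
  Both come from the rate l1 + l2 t^2, where t = (Q / P)^(1/beta) is the ratio of distances, other
  tier to own tier, at which the two received powers balance.\<close>

section \<open>Dyadic rounding of points and balls\<close>

definition grid :: "nat \<Rightarrow> 'b::euclidean_space \<Rightarrow> 'b" where
  "grid n z = (\<Sum>b\<in>Basis. (of_int \<lfloor>2 ^ n * (z \<bullet> b)\<rfloor> / 2 ^ n) *\<^sub>R b)"

text \<open>The l1 bound on the rounding error: each coordinate moves by at most
  \<open>1 / 2 ^ n\<close>. The type argument only supplies the dimension.\<close>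

definition mesh :: "'b::euclidean_space itself \<Rightarrow> nat \<Rightarrow> real" where
  "mesh _ n = real DIM('b) / 2 ^ n"

lemma dist_grid_le: "dist (grid n z) (z::'b::euclidean_space) \<le> mesh TYPE('b) n"
proof -
  have "norm (grid n z - z) \<le> (\<Sum>b\<in>Basis. \<bar>(grid n z - z) \<bullet> b\<bar>)"
    by (rule norm_le_l1)
  also have "\<dots> \<le> (\<Sum>b\<in>(Basis::'b set). 1 / 2 ^ n)"
  proof (rule sum_mono)
    fix b :: 'b assume b: "b \<in> Basis"
    have "(grid n z - z) \<bullet> b = of_int \<lfloor>2 ^ n * (z \<bullet> b)\<rfloor> / 2 ^ n - z \<bullet> b"
      using b by (simp add: grid_def inner_diff_left)
    also have "\<dots> = (of_int \<lfloor>2 ^ n * (z \<bullet> b)\<rfloor> - 2 ^ n * (z \<bullet> b)) / 2 ^ n"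
      by (simp add: field_simps)
    also have "\<bar>\<dots>\<bar> \<le> 1 / 2 ^ n"
    proof -
      have "\<bar>of_int \<lfloor>x\<rfloor> - x\<bar> \<le> 1" for x :: real by linarith
      thus ?thesis by (simp add: abs_divide divide_right_mono)
    qed
    finally show "\<bar>(grid n z - z) \<bullet> b\<bar> \<le> 1 / 2 ^ n" .
  qed
  also have "\<dots> = mesh TYPE('b) n"
    by (simp add: mesh_def)
  finally show ?thesis by (simp add: dist_norm)
qed

lemma mesh_tendsto_0: "mesh TYPE('b::euclidean_space) \<longlonglongrightarrow> 0"
proof -
  have "(\<lambda>n. real DIM('b) * (1 / 2) ^ n) \<longlonglongrightarrow> 0"
    by (intro tendsto_mult_right_zero LIMSEQ_realpow_zero) auto
  thus ?thesis by (simp add: mesh_def[abs_def] power_one_over)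
qed

lemma grid_tendsto: "(\<lambda>n. grid n z) \<longlonglongrightarrow> (z::'b::euclidean_space)"
proof (rule iffD2[OF tendsto_dist_iff])
  show "(\<lambda>n. dist (grid n z) z) \<longlonglongrightarrow> 0"
    by (rule tendsto_sandwich[OF _ _ tendsto_const mesh_tendsto_0[where 'b='b]]) (auto simp: dist_grid_le)
qed

lemma grid_measurable [measurable]: "grid n \<in> borel_measurable borel"
  unfolding grid_def[abs_def] by measurable

text \<open>On a bounded set the floors of the scaled coordinates lie in one integer interval. This
  keeps the sums over grid points in the Campbell formula finite.\<close>

lemma finite_grid_image:
  assumes "bounded (B :: 'b::euclidean_space set)"
  shows "finite (grid n ` B)"
proof -
  obtain R where R: "\<And>x. x \<in> B \<Longrightarrow> norm x \<le> R"
    using assms by (auto simp: bounded_iff)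
  define K :: int where "K = \<lceil>2 ^ n * R\<rceil> + 1"
  let ?F = "\<lambda>h. \<Sum>b\<in>(Basis::'b set). (of_int (h b) / 2 ^ n) *\<^sub>R b"
  have "grid n z \<in> ?F ` (Basis \<rightarrow>\<^sub>E {-K..K})" if z: "z \<in> B" for z
  proof (rule image_eqI)
    let ?h = "\<lambda>b\<in>(Basis::'b set). \<lfloor>2 ^ n * (z \<bullet> b)\<rfloor>"
    show "grid n z = ?F ?h" by (simp add: grid_def)
    have "\<lfloor>2 ^ n * (z \<bullet> b)\<rfloor> \<in> {-K..K}" if b: "b \<in> Basis" for b
    proof -
      have "\<bar>z \<bullet> b\<bar> \<le> R" using Basis_le_norm[OF b, of z] R[OF z] by linarith
      hence "2 ^ n * \<bar>z \<bullet> b\<bar> \<le> 2 ^ n * R" by (intro mult_left_mono) auto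
      hence "\<bar>2 ^ n * (z \<bullet> b)\<bar> \<le> 2 ^ n * R" by (simp add: abs_mult)
      moreover have "\<lfloor>x\<rfloor> \<in> {-(\<lceil>y\<rceil> + 1)..\<lceil>y\<rceil> + 1}" if "\<bar>x\<bar> \<le> y" for x y :: real
        using that unfolding atLeastAtMost_iff by linarith
      ultimately show ?thesis unfolding K_def by blast
    qed
    thus "?h \<in> Basis \<rightarrow>\<^sub>E {-K..K}" by auto
  qed
  hence "grid n ` B \<subseteq> ?F ` (Basis \<rightarrow>\<^sub>E {-K..K})" by blast
  thus ?thesis by (rule finite_subset) (intro finite_imageI finite_PiE; simp)
qed

text \<open>The radius at the grid point is decreased by \<open>(1 + s) * mesh\<close> so that the ball lies in the
  original one: a discretised cell then never loses a point of the true cell.\<close>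
lemma grid_ball_avoids_iff:
  fixes z :: "'b::euclidean_space"
  assumes fin: "\<And>B. bounded B \<Longrightarrow> finite (N \<inter> B)" and s: "0 \<le> s"
  shows "\<forall>\<^sub>F n in sequentially.
    N \<inter> ball (grid n z) (s * norm (grid n z) - (1 + s) * mesh TYPE('b) n) = {}
      \<longleftrightarrow> N \<inter> ball z (s * norm z) = {}"
proof (cases "N \<inter> ball z (s * norm z) = {}")
  case True
  have "ball (grid n z) (s * norm (grid n z) - (1 + s) * mesh TYPE('b) n) \<subseteq> ball z (s * norm z)" for n
  proof
    fix w assume "w \<in> ball (grid n z) (s * norm (grid n z) - (1 + s) * mesh TYPE('b) n)"
    hence w: "dist (grid n z) w < s * norm (grid n z) - (1 + s) * mesh TYPE('b) n" by simp
    have "norm (grid n z) \<le> norm z + mesh TYPE('b) n"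
      using dist_grid_le[of n z] norm_triangle_sub[of "grid n z" z] by (simp add: dist_norm)
    hence "s * norm (grid n z) \<le> s * norm z + s * mesh TYPE('b) n"
      using s mult_left_mono[of "norm (grid n z)" "norm z + mesh TYPE('b) n" s] by (simp add: distrib_left)
    moreover have "dist z w \<le> mesh TYPE('b) n + dist (grid n z) w"
      using dist_grid_le[of n z] dist_triangle3[of z w "grid n z"] by linarith
    moreover have "(1 + s) * mesh TYPE('b) n = mesh TYPE('b) n + s * mesh TYPE('b) n"
      by (simp add: distrib_right)
    ultimately have "dist z w < s * norm z" using w by linarith
    thus "w \<in> ball z (s * norm z)" by simp
  qed
  thus ?thesis using True by (intro always_eventually) blast
next
  case False
  then obtain y where y: "y \<in> N" "dist z y < s * norm z" by auto
  \<comment> \<open>The ball is open, so a point inside it has slack, and the vanishing correction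
    of the radius eventually uses up less than this slack.\<close>
  let ?f = "\<lambda>n. dist (grid n z) y - (s * norm (grid n z) - (1 + s) * mesh TYPE('b) n)"
  have "?f \<longlonglongrightarrow> dist z y - (s * norm z - (1 + s) * 0)"
    by (intro tendsto_intros grid_tendsto mesh_tendsto_0)
  hence "\<forall>\<^sub>F n in sequentially. ?f n < 0"
    using y by (intro order_tendstoD) auto
  thus ?thesis
  proof (rule eventually_mono)
    fix n assume "?f n < 0"
    hence "y \<in> N \<inter> ball (grid n z) (s * norm (grid n z) - (1 + s) * mesh TYPE('b) n)"
      using y(1) by simp
    thus "(N \<inter> ball (grid n z) (s * norm (grid n z) - (1 + s) * mesh TYPE('b) n) = {})
        = (N \<inter> ball z (s * norm z) = {})"
      using False by blast
  qed
qed

section \<open>Gaussian integrals\<close>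

lemma nn_integral_gaussian:
  fixes k :: real
  assumes k: "0 < k"
  shows "(\<integral>\<^sup>+x. ennreal (exp (- (k * x\<^sup>2))) \<partial>lborel) = ennreal (sqrt (pi / k))"
proof -
  \<comment> \<open>Chosen so that \<open>2 * \<sigma>\<^sup>2 = 1 / k\<close>: the integrand is
    then \<open>sqrt (pi / k)\<close> times a normal density.\<close>
  define \<sigma> where "\<sigma> = 1 / sqrt (2 * k)"
  have \<sigma>: "0 < \<sigma>" "\<sigma>\<^sup>2 = 1 / (2 * k)" using k by (auto simp: \<sigma>_def power_divide)
  interpret D: prob_space "density lborel (normal_density 0 \<sigma>)"
    by (rule prob_space_normal_density[OF \<sigma>(1)])
  have eq: "ennreal (exp (- (k * x\<^sup>2))) = ennreal (sqrt (pi / k)) * ennreal (normal_density 0 \<sigma> x)" for x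
    using k unfolding normal_density_def \<sigma>(2)
    by (subst ennreal_mult[symmetric]) (auto simp: field_simps)
  have "(\<integral>\<^sup>+x. ennreal (normal_density 0 \<sigma> x) \<partial>lborel) = 1"
    using D.emeasure_space_1 by (simp add: emeasure_density)
  thus ?thesis unfolding eq by (simp add: nn_integral_cmult)
qed

text \<open>The integrand factors over the two coordinates, each contributing
  \<open>sqrt (pi / k)\<close>.\<close>

lemma nn_integral_gaussian_plane:
  fixes k :: real
  assumes k: "0 < k"
  shows "(\<integral>\<^sup>+z. ennreal (exp (- (k * (norm z)\<^sup>2))) \<partial>(lborel :: pt measure)) = ennreal (pi / k)"
proof -
  have "ennreal (exp (- (k * (norm z)\<^sup>2))) = (\<Prod>b\<in>Basis. ennreal (exp (- (k * (z \<bullet> b)\<^sup>2))))" for z :: pt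
    by (simp add: power2_norm_eq_inner euclidean_inner[of z z] power2_eq_square[symmetric]
        sum_distrib_left prod_ennreal sum_negf[symmetric] exp_sum del: sum_negf)
  hence "(\<integral>\<^sup>+z. ennreal (exp (- (k * (norm z)\<^sup>2))) \<partial>(lborel :: pt measure))
      = (\<integral>\<^sup>+z. (\<Prod>b\<in>Basis. ennreal (exp (- (k * (z \<bullet> b)\<^sup>2)))) \<partial>(lborel :: pt measure))" by simp
  also have "\<dots> = (\<Prod>b\<in>(Basis :: pt set). \<integral>\<^sup>+x. ennreal (exp (- (k * x\<^sup>2))) \<partial>lborel)"
    by (rule nn_integral_lborel_prod) auto
  also have "\<dots> = ennreal (pi / k)"
    using k by (simp add: nn_integral_gaussian ennreal_power)
  finally show ?thesis .
qed

section \<open>Counting events and Poisson means\<close>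

lemma sigma_algebra_count_sigma: "sigma_algebra (space M) (count_sigma M N)"
  unfolding count_sigma_def by (rule sigma_algebra_sigma_sets) auto

lemma count_sigma_count:
  "B \<in> sets lborel \<Longrightarrow> bounded B \<Longrightarrow> {\<omega>\<in>space M. card (N \<omega> \<inter> B) = k} \<in> count_sigma M N"
  unfolding count_sigma_def by (rule sigma_sets.Basic) blast

lemma hppp_finite: "hppp M N lam \<Longrightarrow> \<omega> \<in> space M \<Longrightarrow> bounded B \<Longrightarrow> finite (N \<omega> \<inter> B)"
  unfolding hppp_def by blast

lemma hppp_count:
  "hppp M N lam \<Longrightarrow> B \<in> sets lborel \<Longrightarrow> bounded B \<Longrightarrow>
    measure M {\<omega>\<in>space M. card (N \<omega> \<inter> B) = k}
      = exp (- (lam * measure lborel B)) * (lam * measure lborel B) ^ k / fact k"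
  unfolding hppp_def by blast

text \<open>In \<open>hppp\<close>, measurability of a count is hidden in the independence clause,
  which concerns disjoint sequences; \<open>B\<close> is therefore padded with empty sets.\<close>

lemma (in prob_space) hppp_count_measurable:
  assumes N: "hppp M N lam" and B: "B \<in> sets lborel" "bounded B"
  shows "(\<lambda>\<omega>. card (N \<omega> \<inter> B)) \<in> measurable M (count_space UNIV)"
proof -
  let ?Bs = "\<lambda>i::nat. if i = 0 then B else {}"
  have "indep_vars (\<lambda>_. count_space UNIV) (\<lambda>i \<omega>. card (N \<omega> \<inter> ?Bs i)) UNIV"
    using N B unfolding hppp_def
    by (elim conjE) (drule spec[of _ ?Bs], auto simp: disjoint_family_on_def)
  hence "(\<lambda>\<omega>. card (N \<omega> \<inter> ?Bs 0)) \<in> measurable M (count_space UNIV)"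
    unfolding indep_vars_def by blast
  thus ?thesis by simp
qed

lemma (in prob_space) count_sigma_events:
  assumes "hppp M N lam"
  shows "count_sigma M N \<subseteq> events"
  unfolding count_sigma_def
proof (rule sets.sigma_sets_subset, safe)
  fix B :: "pt set" and k assume "B \<in> sets lborel" "bounded B"
  note [measurable] = hppp_count_measurable[OF assms this]
  show "{\<omega> \<in> space M. card (N \<omega> \<inter> B) = k} \<in> events" by measurable
qed

lemma borel_measurable_LIMSEQ_ennreal:
  fixes f :: "nat \<Rightarrow> 'b \<Rightarrow> ennreal"
  assumes [measurable]: "\<And>n. f n \<in> borel_measurable M"
    and lim: "\<And>x. x \<in> space M \<Longrightarrow> (\<lambda>n. f n x) \<longlonglongrightarrow> g x"
  shows "g \<in> borel_measurable M"
proof (subst measurable_cong)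
  show "g x = liminf (\<lambda>n. f n x)" if "x \<in> space M" for x
    using lim_imp_Liminf[OF _ lim[OF that]] by simp
qed measurable

text \<open>Cancelling k against the factorial shifts the series to m times the exponential series;
  the term at 0 vanishes.\<close>

lemma poisson_mean:
  assumes "0 \<le> (m::real)"
  shows "(\<Sum>k. of_nat k * ennreal (exp (- m) * m ^ k / fact k)) = ennreal m"
proof -
  let ?p = "\<lambda>k. real k * (exp (- m) * m ^ k / fact k)"
  have "(\<lambda>k. m * exp (- m) * (inverse (fact k) * m ^ k)) sums (m * exp (- m) * exp m)"
    using exp_converges[of m] by (intro sums_mult) simp
  moreover have "m * exp (- m) * (inverse (fact k) * m ^ k) = ?p (Suc k)" for k
    by (simp add: field_simps del: of_nat_Suc)
  ultimately have "(\<lambda>k. ?p (Suc k)) sums m"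
    by (simp add: mult.assoc exp_minus_inverse[of m] mult.commute[of "exp (- m)"])
  hence "?p sums m" by (subst (asm) sums_Suc_iff) simp
  moreover have "of_nat k * ennreal (exp (- m) * m ^ k / fact k) = ennreal (?p k)" for k
    using assms by (simp add: ennreal_mult[symmetric] ennreal_of_nat_eq_real_of_nat)
  moreover have "0 \<le> ?p k" for k
    using assms by simp
  ultimately show ?thesis
    using suminf_ennreal_eq[of ?p m] by presburger
qed

text \<open>Independence is given for events, so the count is expanded over its level sets, the
  product rule is applied on each, and the Poisson mean reassembles them.\<close>

lemma (in prob_space) nn_integral_hppp_count_indep:
  assumes U: "hppp M U lam" "0 < lam" and B: "B \<in> sets lborel" "bounded B"
    and E: "E \<in> events"
    and ind: "\<And>F. F \<in> count_sigma M U \<Longrightarrow> prob (E \<inter> F) = prob E * prob F"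
  shows "(\<integral>\<^sup>+\<omega>. indicator E \<omega> * of_nat (card (U \<omega> \<inter> B)) \<partial>M)
    = emeasure M E * (ennreal lam * emeasure lborel B)"
proof -
  note [measurable] = E hppp_count_measurable[OF U(1) B]
  let ?F = "\<lambda>k. {\<omega>\<in>space M. card (U \<omega> \<inter> B) = k}"
  let ?m = "lam * measure lborel B"
  have m: "0 \<le> ?m" using U by simp
  have "indicator E \<omega> * of_nat (card (U \<omega> \<inter> B)) = (\<Sum>k. of_nat k * indicator (E \<inter> ?F k) \<omega> :: ennreal)"
    if "\<omega> \<in> space M" for \<omega>
  proof -
    have "(\<Sum>k. of_nat k * indicator (E \<inter> ?F k) \<omega> :: ennreal)
        = (\<Sum>k\<in>{card (U \<omega> \<inter> B)}. of_nat k * indicator (E \<inter> ?F k) \<omega>)"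
      by (rule suminf_finite) (auto simp: indicator_def)
    thus ?thesis using that by (simp add: indicator_def)
  qed
  hence "(\<integral>\<^sup>+\<omega>. indicator E \<omega> * of_nat (card (U \<omega> \<inter> B)) \<partial>M)
      = (\<integral>\<^sup>+\<omega>. (\<Sum>k. of_nat k * indicator (E \<inter> ?F k) \<omega>) \<partial>M)"
    by (intro nn_integral_cong) auto
  also have "\<dots> = (\<Sum>k. of_nat k * emeasure M (E \<inter> ?F k))"
    by (subst nn_integral_suminf) (auto simp: nn_integral_cmult)
  also have "\<dots> = (\<Sum>k. emeasure M E * (of_nat k * ennreal (exp (- ?m) * ?m ^ k / fact k)))"
  proof (rule suminf_cong)
    fix k
    have "emeasure M (E \<inter> ?F k) = ennreal (prob E * prob (?F k))"
      using ind[OF count_sigma_count[OF B]] by (simp add: emeasure_eq_measure)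
    also have "\<dots> = emeasure M E * ennreal (prob (?F k))"
      by (simp add: ennreal_mult emeasure_eq_measure)
    finally show "of_nat k * emeasure M (E \<inter> ?F k)
        = emeasure M E * (of_nat k * ennreal (exp (- ?m) * ?m ^ k / fact k))"
      unfolding hppp_count[OF U(1) B] by (simp only: mult_ac)
  qed
  also have "\<dots> = emeasure M E * ennreal ?m"
    by (simp add: poisson_mean[OF m])
  also have "ennreal ?m = ennreal lam * emeasure lborel B"
    using U B emeasure_bounded_finite[OF B(2)]
    by (simp add: ennreal_mult emeasure_eq_ennreal_measure)
  finally show ?thesis .
qed

section \<open>Campbell formula for a random set independent of the users\<close>

text \<open>The events \<open>C n v\<close> describe a discretised version of \<open>V\<close> that
  is constant on dyadic cubes. For it the identity is a finite sum over cubes, and dominated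
  convergence passes to the limit on both sides: in \<open>\<omega>\<close> below the number of
  users in \<open>B\<close>, in \<open>z\<close> below the indicator of \<open>B\<close>. The two
  measurability claims feed the monotone limit over growing balls.\<close>

lemma (in prob_space) campbell_indep_bounded:
  assumes U: "hppp M U lam" "0 < lam"
    and C: "\<And>n v. C n v \<in> events"
    and ind: "\<And>n v F. F \<in> count_sigma M U \<Longrightarrow> prob (C n v \<inter> F) = prob (C n v) * prob F"
    and lim: "\<And>\<omega> z. \<omega> \<in> space M \<Longrightarrow> \<forall>\<^sub>F n in sequentially. \<omega> \<in> C n (grid n z) \<longleftrightarrow> z \<in> V \<omega>"
    and B: "B \<in> sets lborel" "bounded B"
  shows "(\<integral>\<^sup>+\<omega>. of_nat (card (U \<omega> \<inter> B \<inter> V \<omega>)) \<partial>M)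
      = ennreal lam * (\<integral>\<^sup>+z. indicator B z * emeasure M {\<omega>\<in>space M. z \<in> V \<omega>} \<partial>lborel)"
    and "(\<lambda>\<omega>. of_nat (card (U \<omega> \<inter> B \<inter> V \<omega>)) :: ennreal) \<in> borel_measurable M"
    and "(\<lambda>z. indicator B z * emeasure M {\<omega>\<in>space M. z \<in> V \<omega>}) \<in> borel_measurable lborel"
proof -
  note [measurable] = C B
  have [measurable]: "grid n -` {v} \<in> sets borel" for n and v :: pt
    using measurable_sets[OF grid_measurable, of "{v}" n] by simp
  have [measurable]: "(\<lambda>\<omega>. card (U \<omega> \<inter> (B \<inter> grid n -` {v}))) \<in> measurable M (count_space UNIV)" for n v
    using B by (intro hppp_count_measurable[OF U(1)] bounded_Int) auto
  define f where "f n \<omega> = (\<Sum>v\<in>grid n ` B. indicator (C n v) \<omega> * of_nat (card (U \<omega> \<inter> (B \<inter> grid n -` {v}))) :: ennreal)"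
    for n \<omega>
  define g where "g \<omega> = (of_nat (card (U \<omega> \<inter> B \<inter> V \<omega>)) :: ennreal)" for \<omega>
  define q where "q n z = emeasure M (C n (grid n z))" for n z
  define Q where "Q z = emeasure M {\<omega>\<in>space M. z \<in> V \<omega>}" for z

  have f_card: "f n \<omega> = of_nat (card {z\<in>U \<omega> \<inter> B. \<omega> \<in> C n (grid n z)})" if \<omega>: "\<omega> \<in> space M" for n \<omega>
  proof -
    have fin: "finite (U \<omega> \<inter> B)" by (rule hppp_finite[OF U(1) \<omega> B(2)])
    let ?S = "{z\<in>U \<omega> \<inter> B. \<omega> \<in> C n (grid n z)}"
    have "card ?S = (\<Sum>v\<in>grid n ` B. card {z\<in>?S. grid n z = v})"
      using finite_subset[OF _ fin, of ?S] finite_grid_image[OF B(2)]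
      by (subst card_eq_sum, subst sum.group[of ?S "grid n ` B" "grid n" "\<lambda>_. 1", symmetric]) auto
    also have "of_nat \<dots> = f n \<omega>"
      unfolding f_def of_nat_sum
    proof (rule sum.cong)
      fix v
      have "{z\<in>?S. grid n z = v} = (if \<omega> \<in> C n v then U \<omega> \<inter> (B \<inter> grid n -` {v}) else {})" by auto
      thus "(of_nat (card {z\<in>?S. grid n z = v}) :: ennreal)
          = indicator (C n v) \<omega> * of_nat (card (U \<omega> \<inter> (B \<inter> grid n -` {v})))" by simp
    qed simp
    finally show ?thesis by simp
  qed
  \<comment> \<open>Only finitely many users lie in \<open>B\<close>, so a single \<open>n\<close>
    works for all of them and the sequence is eventually constant.\<close>
  have f_lim: "(\<lambda>n. f n \<omega>) \<longlonglongrightarrow> g \<omega>" if \<omega>: "\<omega> \<in> space M" for \<omega>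
  proof -
    have "\<forall>\<^sub>F n in sequentially. \<forall>z\<in>U \<omega> \<inter> B. \<omega> \<in> C n (grid n z) \<longleftrightarrow> z \<in> V \<omega>"
      using hppp_finite[OF U(1) \<omega> B(2)] lim[OF \<omega>] by (intro eventually_ball_finite) auto
    hence "\<forall>\<^sub>F n in sequentially. f n \<omega> = g \<omega>"
    proof (rule eventually_mono)
      fix n assume "\<forall>z\<in>U \<omega> \<inter> B. \<omega> \<in> C n (grid n z) \<longleftrightarrow> z \<in> V \<omega>"
      hence "{z\<in>U \<omega> \<inter> B. \<omega> \<in> C n (grid n z)} = U \<omega> \<inter> B \<inter> V \<omega>" by blast
      thus "f n \<omega> = g \<omega>" by (simp add: f_card[OF \<omega>] g_def)
    qed
    thus ?thesis by (rule tendsto_eventually)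
  qed
  have f_meas [measurable]: "f n \<in> borel_measurable M" for n
    unfolding f_def[abs_def] by measurable
  have g_meas [measurable]: "g \<in> borel_measurable M"
    by (rule borel_measurable_LIMSEQ_ennreal[OF f_meas f_lim])
  show "(\<lambda>\<omega>. of_nat (card (U \<omega> \<inter> B \<inter> V \<omega>)) :: ennreal) \<in> borel_measurable M"
    using g_meas unfolding g_def[abs_def] .

  have [measurable]: "(\<lambda>\<omega>. card (U \<omega> \<inter> B)) \<in> measurable M (count_space UNIV)"
    by (rule hppp_count_measurable[OF U(1) B])
  have B_fin: "emeasure lborel B < \<infinity>"
    using emeasure_bounded_finite[OF B(2)] by simp
  \<comment> \<open>The trivial event \<open>space M\<close> turns the product formula into the mean
    count of \<open>B\<close>, which makes the dominating function integrable.\<close>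
  have card_int: "(\<integral>\<^sup>+\<omega>. of_nat (card (U \<omega> \<inter> B)) \<partial>M) < \<infinity>"
  proof -
    have "(\<integral>\<^sup>+\<omega>. of_nat (card (U \<omega> \<inter> B)) \<partial>M)
        = (\<integral>\<^sup>+\<omega>. indicator (space M) \<omega> * of_nat (card (U \<omega> \<inter> B)) \<partial>M)"
      by (intro nn_integral_cong) simp
    also have "\<dots> = emeasure M (space M) * (ennreal lam * emeasure lborel B)"
      using count_sigma_events[OF U(1)] prob_space
      by (intro nn_integral_hppp_count_indep[OF U B]) (auto simp: Int_absorb1 sets.sets_into_space)
    also have "\<dots> < \<infinity>"
      using B_fin by (simp add: emeasure_space_1 ennreal_mult_less_top)
    finally show ?thesis .
  qed
  have f_int_lim: "(\<lambda>n. \<integral>\<^sup>+\<omega>. f n \<omega> \<partial>M) \<longlonglongrightarrow> (\<integral>\<^sup>+\<omega>. g \<omega> \<partial>M)"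
  proof (rule nn_integral_dominated_convergence[OF _ _ _ _ card_int])
    show "AE \<omega> in M. f n \<omega> \<le> of_nat (card (U \<omega> \<inter> B))" for n
      using hppp_finite[OF U(1) _ B(2)]
      by (intro AE_I2) (auto simp: f_card intro!: card_mono)
  qed (use f_lim in auto)

  have Q_lim: "(\<lambda>n. q n z) \<longlonglongrightarrow> Q z" for z
  proof -
    let ?W = "{\<omega>\<in>space M. z \<in> V \<omega>}"
    \<comment> \<open>Measurability of this event is not assumed; it follows because the event is
      the lower limit of the events at the grid points.\<close>
    have W: "?W = (\<Union>m. \<Inter>n\<in>{m..}. C n (grid n z))"
    proof (rule set_eqI)
      fix \<omega>
      show "\<omega> \<in> ?W \<longleftrightarrow> \<omega> \<in> (\<Union>m. \<Inter>n\<in>{m..}. C n (grid n z))"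
      proof (cases "\<omega> \<in> space M")
        case True
        from lim[OF True, of z] obtain m where m: "\<And>n. n \<ge> m \<Longrightarrow> \<omega> \<in> C n (grid n z) \<longleftrightarrow> z \<in> V \<omega>"
          unfolding eventually_sequentially by blast
        have "z \<in> V \<omega>" if "\<And>n. n \<ge> k \<Longrightarrow> \<omega> \<in> C n (grid n z)" for k
          using m[of "max k m"] that[of "max k m"] by simp
        with m True show ?thesis by auto
      next
        case False
        hence "\<omega> \<notin> C n (grid n z)" for n using sets.sets_into_space[OF C] by blast
        with False show ?thesis by auto
      qed
    qed
    have [measurable]: "?W \<in> events" unfolding W by measurable
    have "(\<lambda>n. \<integral>\<^sup>+\<omega>. indicator (C n (grid n z)) \<omega> \<partial>M) \<longlonglongrightarrow> (\<integral>\<^sup>+\<omega>. indicator ?W \<omega> \<partial>M)"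
    proof (rule nn_integral_dominated_convergence[where w="\<lambda>_. 1"])
      show "AE \<omega> in M. (\<lambda>n. indicator (C n (grid n z)) \<omega> :: ennreal) \<longlonglongrightarrow> indicator ?W \<omega>"
      proof (rule AE_I2)
        fix \<omega> assume \<omega>: "\<omega> \<in> space M"
        show "(\<lambda>n. indicator (C n (grid n z)) \<omega> :: ennreal) \<longlonglongrightarrow> indicator ?W \<omega>"
          by (rule tendsto_eventually, rule eventually_mono[OF lim[OF \<omega>, of z]])
            (use \<omega> in \<open>auto simp: indicator_def\<close>)
      qed
    qed (auto simp: emeasure_space_1 indicator_def)
    thus ?thesis by (simp add: q_def Q_def)
  qed
  \<comment> \<open>As a function of \<open>z\<close> this is a step function on the cubes, hence
    measurable, and the limit over \<open>n\<close> inherits measurability.\<close>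
  have q_sum: "indicator B z * q n z = (\<Sum>v\<in>grid n ` B. emeasure M (C n v) * indicator (B \<inter> grid n -` {v}) z)"
    for n z
  proof (cases "z \<in> B")
    case True
    have "(\<Sum>v\<in>grid n ` B. emeasure M (C n v) * indicator (B \<inter> grid n -` {v}) z)
        = (\<Sum>v\<in>grid n ` B. if v = grid n z then emeasure M (C n v) else 0)"
      using True by (intro sum.cong) (auto simp: indicator_def)
    also have "\<dots> = q n z"
      using True finite_grid_image[OF B(2)] by (simp add: q_def)
    finally show ?thesis using True by simp
  qed simp
  have q_meas: "(\<lambda>z. indicator B z * q n z) \<in> borel_measurable lborel" for n
    unfolding q_sum by measurable
  have f_int: "(\<integral>\<^sup>+\<omega>. f n \<omega> \<partial>M) = ennreal lam * (\<integral>\<^sup>+z. indicator B z * q n z \<partial>lborel)" for n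
  proof -
    have "(\<integral>\<^sup>+\<omega>. f n \<omega> \<partial>M)
        = (\<Sum>v\<in>grid n ` B. emeasure M (C n v) * (ennreal lam * emeasure lborel (B \<inter> grid n -` {v})))"
      unfolding f_def using B
      by (subst nn_integral_sum) (auto intro!: sum.cong nn_integral_hppp_count_indep[OF U] C ind)
    also have "\<dots> = ennreal lam * (\<integral>\<^sup>+z. indicator B z * q n z \<partial>lborel)"
      unfolding q_sum
      by (subst nn_integral_sum) (auto simp: nn_integral_cmult sum_distrib_left mult_ac)
    finally show ?thesis .
  qed
  have Q_meas: "(\<lambda>z. indicator B z * Q z) \<in> borel_measurable lborel"
    by (rule borel_measurable_LIMSEQ_ennreal[of "\<lambda>n z. indicator B z * q n z"])
      (use q_meas Q_lim in \<open>auto simp: indicator_def\<close>)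
  have Q_int_lim: "(\<lambda>n. \<integral>\<^sup>+z. indicator B z * q n z \<partial>lborel) \<longlonglongrightarrow> (\<integral>\<^sup>+z. indicator B z * Q z \<partial>lborel)"
  proof (rule nn_integral_dominated_convergence[where w="indicator B"])
    show "AE z in lborel. indicator B z * q n z \<le> indicator B z" for n
      by (rule AE_I2) (simp add: q_def indicator_def emeasure_le_1)
    show "AE z in lborel. (\<lambda>n. indicator B z * q n z) \<longlonglongrightarrow> indicator B z * Q z"
      by (rule AE_I2) (auto simp: indicator_def Q_lim)
    show "(\<integral>\<^sup>+z. indicator B z \<partial>lborel) < \<infinity>" using B_fin nn_integral_indicator[OF B(1)] by simp
  qed (use q_meas Q_meas in auto)
  have "(\<lambda>n. \<integral>\<^sup>+\<omega>. f n \<omega> \<partial>M) \<longlonglongrightarrow> ennreal lam * (\<integral>\<^sup>+z. indicator B z * Q z \<partial>lborel)"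
    unfolding f_int by (intro ennreal_tendsto_cmult Q_int_lim) simp
  from LIMSEQ_unique[OF f_int_lim this]
  show "(\<integral>\<^sup>+\<omega>. of_nat (card (U \<omega> \<inter> B \<inter> V \<omega>)) \<partial>M)
      = ennreal lam * (\<integral>\<^sup>+z. indicator B z * emeasure M {\<omega>\<in>space M. z \<in> V \<omega>} \<partial>lborel)"
    by (simp add: g_def Q_def)
  show "(\<lambda>z. indicator B z * emeasure M {\<omega>\<in>space M. z \<in> V \<omega>}) \<in> borel_measurable lborel"
    using Q_meas by (simp add: Q_def)
qed

text \<open>Since \<open>card\<close> is \<open>0\<close> on infinite sets, the finiteness assumption matters: it makes
  \<open>U \<omega> \<inter> V \<omega>\<close> almost surely finite.\<close>
lemma (in prob_space) campbell_indep:
  assumes U: "hppp M U lam" "0 < lam"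
    and C: "\<And>n v. C n v \<in> events"
    and ind: "\<And>n v F. F \<in> count_sigma M U \<Longrightarrow> prob (C n v \<inter> F) = prob (C n v) * prob F"
    and lim: "\<And>\<omega> z. \<omega> \<in> space M \<Longrightarrow> \<forall>\<^sub>F n in sequentially. \<omega> \<in> C n (grid n z) \<longleftrightarrow> z \<in> V \<omega>"
    and fin: "(\<integral>\<^sup>+z. emeasure M {\<omega>\<in>space M. z \<in> V \<omega>} \<partial>lborel) < \<infinity>"
  shows "(\<integral>\<^sup>+\<omega>. of_nat (card (U \<omega> \<inter> V \<omega>)) \<partial>M)
      = ennreal lam * (\<integral>\<^sup>+z. emeasure M {\<omega>\<in>space M. z \<in> V \<omega>} \<partial>lborel)"
proof -
  define Q where "Q z = emeasure M {\<omega>\<in>space M. z \<in> V \<omega>}" for z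
  let ?B = "\<lambda>n. ball 0 (real n) :: pt set"
  define f where "f n \<omega> = (of_nat (card (U \<omega> \<inter> ?B n \<inter> V \<omega>)) :: ennreal)" for n \<omega>
  note bdd = campbell_indep_bounded[OF U C ind lim, of "?B n" for n, folded Q_def f_def]
  have inc: "incseq (\<lambda>n. U \<omega> \<inter> ?B n \<inter> V \<omega>)" for \<omega>
    by (auto simp: incseq_def)
  have UN: "(\<Union>n. ?B n) = UNIV"
    by (auto intro: reals_Archimedean2)
  \<comment> \<open>Counting measure, unlike \<open>card\<close>, is continuous along increasing
    unions even when the union is infinite.\<close>
  have f_emeasure: "f n \<omega> = emeasure (count_space UNIV) (U \<omega> \<inter> ?B n \<inter> V \<omega>)"
    if "\<omega> \<in> space M" for n \<omega>
    using hppp_finite[OF U(1) that, of "?B n"] by (simp add: f_def)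
  have SUP_f: "(SUP n. f n \<omega>) = emeasure (count_space UNIV) (U \<omega> \<inter> V \<omega>)" if "\<omega> \<in> space M" for \<omega>
  proof -
    have "(\<Union>n. U \<omega> \<inter> ?B n \<inter> V \<omega>) = U \<omega> \<inter> V \<omega>" using UN by blast
    thus ?thesis
      using SUP_emeasure_incseq[OF _ inc[of \<omega>], of "count_space UNIV"] that
      by (simp add: f_emeasure)
  qed
  have f_meas [measurable]: "f n \<in> borel_measurable M" for n
    using bdd(2) by (simp add: f_def[abs_def])
  have "(\<integral>\<^sup>+\<omega>. (SUP n. f n \<omega>) \<partial>M) = (SUP n. \<integral>\<^sup>+\<omega>. f n \<omega> \<partial>M)"
  proof (rule nn_integral_monotone_convergence_SUP_AE)
    show "AE \<omega> in M. f i \<omega> \<le> f (Suc i) \<omega>" for i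
      by (intro AE_I2) (auto simp only: f_emeasure sets_count_space Pow_UNIV intro!: emeasure_mono incseq_SucD[OF inc])
  qed auto
  also have "\<dots> = (SUP n. ennreal lam * (\<integral>\<^sup>+z. indicator (?B n) z * Q z \<partial>lborel))"
    using bdd(1) by (simp add: f_def)
  also have "\<dots> = ennreal lam * (SUP n. \<integral>\<^sup>+z. indicator (?B n) z * Q z \<partial>lborel)"
    by (simp add: SUP_mult_left_ennreal)
  also have "(SUP n. \<integral>\<^sup>+z. indicator (?B n) z * Q z \<partial>lborel)
      = (\<integral>\<^sup>+z. (SUP n. indicator (?B n) z * Q z) \<partial>lborel)"
    using bdd(3)
    by (intro nn_integral_monotone_convergence_SUP[symmetric])
      (auto simp: incseq_def le_fun_def indicator_def)
  also have "\<dots> = (\<integral>\<^sup>+z. Q z \<partial>lborel)"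
  proof (rule nn_integral_cong)
    fix z :: pt
    obtain n where "z \<in> ?B n" using UN by blast
    thus "(SUP n. indicator (?B n) z * Q z) = Q z"
      by (intro antisym SUP_least SUP_upper2[of n]) (auto simp: indicator_def)
  qed
  finally have main: "(\<integral>\<^sup>+\<omega>. (SUP n. f n \<omega>) \<partial>M) = ennreal lam * (\<integral>\<^sup>+z. Q z \<partial>lborel)" .
  have "AE \<omega> in M. (SUP n. f n \<omega>) \<noteq> \<infinity>"
    using fin main by (intro nn_integral_PInf_AE) (auto simp: Q_def ennreal_mult_eq_top_iff)
  hence "AE \<omega> in M. of_nat (card (U \<omega> \<inter> V \<omega>)) = (SUP n. f n \<omega>)"
    using AE_space by eventually_elim (auto simp: SUP_f emeasure_count_space split: if_splits)
  hence "(\<integral>\<^sup>+\<omega>. of_nat (card (U \<omega> \<inter> V \<omega>)) \<partial>M) = (\<integral>\<^sup>+\<omega>. (SUP n. f n \<omega>) \<partial>M)"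
    by (rule nn_integral_cong_AE)
  with main show ?thesis by (simp add: Q_def)
qed

section \<open>Void probabilities, cell geometry and the mean cell count\<close>

lemma hppp_void_eq:
  assumes "hppp M N lam" "bounded B"
  shows "{\<omega>\<in>space M. N \<omega> \<inter> B = {}} = {\<omega>\<in>space M. card (N \<omega> \<inter> B) = 0}"
  using hppp_finite[OF assms(1) _ assms(2)] by auto

lemma hppp_void_count_sigma:
  assumes "hppp M N lam" "B \<in> sets lborel" "bounded B"
  shows "{\<omega>\<in>space M. N \<omega> \<inter> B = {}} \<in> count_sigma M N"
  unfolding hppp_void_eq[OF assms(1,3)] by (rule count_sigma_count[OF assms(2,3)])

lemma hppp_void_prob:
  assumes "hppp M N lam" "B \<in> sets lborel" "bounded B"
  shows "measure M {\<omega>\<in>space M. N \<omega> \<inter> B = {}} = exp (- (lam * measure lborel B))"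
  unfolding hppp_void_eq[OF assms(1,3)] hppp_count[OF assms] by simp

text \<open>Taking roots of order \<open>\<beta>\<close> makes the comparison of received powers
  linear in the distances.\<close>

lemma powr_weighted_le_iff:
  fixes P Q \<beta> x y :: real
  assumes "0 < P" "0 < Q" "0 < \<beta>" "0 \<le> x" "0 \<le> y"
  shows "Q * x powr \<beta> \<le> P * y powr \<beta> \<longleftrightarrow> (Q / P) powr (1 / \<beta>) * x \<le> y"
proof -
  let ?t = "(Q / P) powr (1 / \<beta>)"
  have "(?t * x) powr \<beta> = Q / P * x powr \<beta>"
    using assms by (simp add: powr_mult powr_powr)
  hence "Q * x powr \<beta> = P * (?t * x) powr \<beta>"
    using assms by simp
  hence "Q * x powr \<beta> \<le> P * y powr \<beta> \<longleftrightarrow> (?t * x) powr \<beta> \<le> y powr \<beta>"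
    using assms by (simp only: mult_le_cancel_left_pos)
  also have "\<dots> \<longleftrightarrow> ?t * x \<le> y"
    using assms powr_less_mono2[of \<beta> y "?t * x"] powr_mono2[of \<beta> "?t * x" y]
    by (auto simp: not_le[symmetric])
  finally show ?thesis .
qed

text \<open>A station beats the origin at \<open>z\<close> exactly when it is closer than
  \<open>norm z\<close>, scaled by the balancing ratio for the other tier. The factor
  \<open>1\<close> matches the shape \<open>s * norm z\<close> of the rounding lemma.\<close>

lemma mem_het_cell_origin_iff:
  assumes "0 < P" "0 < Q" "0 < \<beta>"
  shows "z \<in> het_cell \<beta> (stations P Q (insert 0 A) B) 0 P \<longleftrightarrow>
    A \<inter> ball z (1 * norm z) = {} \<and> B \<inter> ball z ((Q / P) powr (1 / \<beta>) * norm z) = {}"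
  using powr_weighted_le_iff[of P Q \<beta> "norm z"] powr_weighted_le_iff[of P P \<beta> "norm z"] assms
  by (auto simp: het_cell_def stations_def ball_Un dist_commute disjoint_iff not_less)

text \<open>Stations of the same tier have equal power and are no closer than \<open>x\<close>, so
  only the other tier imposes a condition.\<close>

lemma origin_mem_het_cell_iff:
  assumes "0 < P" "0 < Q" "0 < \<beta>" "is_closest A x"
  shows "0 \<in> het_cell \<beta> (stations P Q A B) x P \<longleftrightarrow>
    (\<forall>y\<in>B. (Q / P) powr (1 / \<beta>) * norm x \<le> norm y)"
  using powr_weighted_le_iff[of P Q \<beta> "norm x"] powr_weighted_le_iff[of P P \<beta> "norm x"] assms
  by (auto simp: het_cell_def stations_def ball_Un is_closest_def)

lemma content_ball_plane: "0 \<le> r \<Longrightarrow> measure lborel (ball (z::pt) r) = pi * r\<^sup>2"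
  by (simp add: content_ball unit_ball_vol_2)

lemma content_cball_plane: "0 \<le> r \<Longrightarrow> measure lborel (cball (z::pt) r) = pi * r\<^sup>2"
  by (simp add: content_cball unit_ball_vol_2)

lemma (in prob_space) mean_cell_count:
  fixes P Q \<beta> l1 l2 lam :: real
  assumes pos: "0 < P" "0 < Q" "0 < \<beta>" "0 < l1" "0 < l2" "0 < lam"
    and N1: "hppp M N1 l1" and N2: "hppp M N2 l2" and U: "hppp M U lam"
    and ind: "\<And>E1 E2 E3. E1 \<in> count_sigma M N1 \<Longrightarrow> E2 \<in> count_sigma M N2 \<Longrightarrow> E3 \<in> count_sigma M U
      \<Longrightarrow> prob (E1 \<inter> E2 \<inter> E3) = prob E1 * prob E2 * prob E3"
  shows "(\<integral>\<^sup>+\<omega>. ennreal (real (card (U \<omega> \<inter> het_cell \<beta> (stations P Q (insert 0 (N1 \<omega>)) (N2 \<omega>)) 0 P))) \<partial>M)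
    = ennreal (lam / (l1 + l2 * (Q / P) powr (2 / \<beta>)))"
proof -
  define t where "t = (Q / P) powr (1 / \<beta>)"
  have t: "0 < t" "t\<^sup>2 = (Q / P) powr (2 / \<beta>)"
    using pos by (auto simp: t_def powr_power)
  \<comment> \<open>The two balls to be avoided have areas \<open>pi * (norm z)\<^sup>2\<close> and
    \<open>pi * t\<^sup>2 * (norm z)\<^sup>2\<close>; weighting them by the intensities gives the
    exponent.\<close>
  define k where "k = pi * (l1 + l2 * t\<^sup>2)"
  have k: "0 < k" using pos t by (simp add: k_def add_pos_pos)
  define V where "V \<omega> = het_cell \<beta> (stations P Q (insert 0 (N1 \<omega>)) (N2 \<omega>)) 0 P" for \<omega>
  define D where "D N s n v = {\<omega>\<in>space M. N \<omega> \<inter> ball v (s * norm v - (1 + s) * mesh TYPE(pt) n) = {}}"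
    for N :: "'a \<Rightarrow> pt set" and s n v
  have V: "z \<in> V \<omega> \<longleftrightarrow> N1 \<omega> \<inter> ball z (1 * norm z) = {} \<and> N2 \<omega> \<inter> ball z (t * norm z) = {}" for z \<omega>
    unfolding V_def t_def using pos by (intro mem_het_cell_origin_iff)
  have D: "D N s n v \<in> count_sigma M N" if "hppp M N l" for N l s n v
    unfolding D_def using that by (intro hppp_void_count_sigma) auto
  \<comment> \<open>As a third event, the whole space reduces the triple product rule to the rule
    for the two tiers.\<close>
  have space_U: "space M \<in> count_sigma M U"
    unfolding count_sigma_def by (rule sigma_sets_top)
  have ind2: "prob (E1 \<inter> E2) = prob E1 * prob E2" if "E1 \<in> count_sigma M N1" "E2 \<in> count_sigma M N2" for E1 E2
  proof -
    have "E1 \<inter> E2 \<inter> space M = E1 \<inter> E2"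
      using that(1) count_sigma_events[OF N1] sets.sets_into_space by blast
    thus ?thesis using ind[OF that space_U] by (simp add: prob_space)
  qed
  have Q_eq: "emeasure M {\<omega>\<in>space M. z \<in> V \<omega>} = ennreal (exp (- (k * (norm z)\<^sup>2)))" for z
  proof -
    let ?E = "\<lambda>N s. {\<omega>\<in>space M. N \<omega> \<inter> ball z (s * norm z) = {}}"
    have "{\<omega>\<in>space M. z \<in> V \<omega>} = ?E N1 1 \<inter> ?E N2 t"
      unfolding V by blast
    also have "prob \<dots> = prob (?E N1 1) * prob (?E N2 t)"
      by (intro ind2 hppp_void_count_sigma[OF N1] hppp_void_count_sigma[OF N2]) auto
    also have "\<dots> = exp (- (l1 * (pi * (1 * norm z)\<^sup>2))) * exp (- (l2 * (pi * (t * norm z)\<^sup>2)))"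
      using t by (subst hppp_void_prob[OF N1] hppp_void_prob[OF N2]; (subst content_ball_plane)?; simp)+
    also have "\<dots> = exp (- (k * (norm z)\<^sup>2))"
      by (simp add: k_def exp_add[symmetric] power_mult_distrib algebra_simps)
    finally show ?thesis by (simp add: emeasure_eq_measure)
  qed
  have int_Q: "(\<integral>\<^sup>+z. emeasure M {\<omega>\<in>space M. z \<in> V \<omega>} \<partial>lborel) = ennreal (pi / k)"
    unfolding Q_eq by (rule nn_integral_gaussian_plane[OF k])
  have "(\<integral>\<^sup>+\<omega>. of_nat (card (U \<omega> \<inter> V \<omega>)) \<partial>M)
      = ennreal lam * (\<integral>\<^sup>+z. emeasure M {\<omega>\<in>space M. z \<in> V \<omega>} \<partial>lborel)"
  proof (rule campbell_indep[OF U pos(6), where C="\<lambda>n v. D N1 1 n v \<inter> D N2 t n v"])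
    fix n v
    show "D N1 1 n v \<inter> D N2 t n v \<in> events"
      using D[OF N1] D[OF N2] count_sigma_events[OF N1] count_sigma_events[OF N2] by blast
    show "prob (D N1 1 n v \<inter> D N2 t n v \<inter> F) = prob (D N1 1 n v \<inter> D N2 t n v) * prob F"
      if "F \<in> count_sigma M U" for F
      by (simp add: ind[OF D[OF N1] D[OF N2] that] ind2[OF D[OF N1] D[OF N2]])
  next
    fix \<omega> z assume \<omega>: "\<omega> \<in> space M"
    show "\<forall>\<^sub>F n in sequentially. \<omega> \<in> D N1 1 n (grid n z) \<inter> D N2 t n (grid n z) \<longleftrightarrow> z \<in> V \<omega>"
      using eventually_conj[OF grid_ball_avoids_iff[OF hppp_finite[OF N1 \<omega>], of 1 z]
          grid_ball_avoids_iff[OF hppp_finite[OF N2 \<omega>], of t z]] t \<omega>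
      unfolding V D_def by (auto elim!: eventually_mono)
  qed (simp add: int_Q)
  also have "\<dots> = ennreal (lam * (pi / k))"
    using pos k by (simp only: int_Q) (simp add: ennreal_mult[symmetric])
  also have "lam * (pi / k) = lam / (l1 + l2 * (Q / P) powr (2 / \<beta>))"
    by (simp add: k_def t)
  finally show ?thesis by (simp add: V_def ennreal_of_nat_eq_real_of_nat)
qed

section \<open>Void area around the origin and its exponential law\<close>

text \<open>A closest point may fail to be unique, but its norm does not depend on the
  choice.\<close>

lemma is_closest_infdist:
  assumes "is_closest \<Phi> x"
  shows "infdist 0 \<Phi> = norm x"
proof -
  have "x \<in> \<Phi>" and "\<And>y. y \<in> \<Phi> \<Longrightarrow> norm x \<le> norm y"
    using assms by (auto simp: is_closest_def)
  thus ?thesis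
    by (intro antisym infdist_le2[of x]) (auto simp: infdist_def intro!: cINF_greatest)
qed

text \<open>Only points in the closed disc reaching some fixed point compete, and local finiteness
  leaves finitely many of them.\<close>

lemma ex_is_closest:
  assumes fin: "\<And>B. bounded B \<Longrightarrow> finite (\<Phi> \<inter> B)" and "\<Phi> \<noteq> {}"
  shows "\<exists>x. is_closest \<Phi> x"
proof -
  obtain y where y: "y \<in> \<Phi>" using assms(2) by blast
  let ?S = "\<Phi> \<inter> cball 0 (norm y)"
  have "finite ?S" "?S \<noteq> {}" using y by (auto intro!: fin)
  then obtain x where "is_arg_min norm (\<lambda>x. x \<in> ?S) x"
    using ex_is_arg_min_if_finite by blast
  hence x: "x \<in> ?S" "\<And>z. z \<in> ?S \<Longrightarrow> norm x \<le> norm z"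
    by (simp_all add: is_arg_min_linorder)
  have "norm x \<le> norm z" if "z \<in> \<Phi>" for z
    using x(2)[of z] x(1) that by (cases "z \<in> ?S") auto
  with x(1) show ?thesis by (auto simp: is_closest_def)
qed

text \<open>Area rather than distance, because its exponential rate is then the intensity itself.
  For the empty set \<open>infdist\<close> defaults to 0, not to infinity, so emptiness is treated
  as a separate null event.\<close>

definition void_area :: "pt set \<Rightarrow> real" where
  "void_area \<Phi> = pi * (infdist 0 \<Phi>)\<^sup>2"

lemma void_area_nonneg: "0 \<le> void_area \<Phi>"
  by (simp add: void_area_def)

lemma void_area_empty [simp]: "void_area {} = 0"
  by (simp add: void_area_def infdist_def)

text \<open>The disc of area \<open>a\<close> has radius \<open>sqrt (a / pi)\<close>; the strict
  inequality corresponds to the closed disc. Nonemptiness enters through the default value.\<close>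

lemma less_void_area_iff:
  assumes fin: "\<And>B. bounded B \<Longrightarrow> finite (\<Phi> \<inter> B)" and a: "0 \<le> a"
  shows "a < void_area \<Phi> \<longleftrightarrow> \<Phi> \<noteq> {} \<and> \<Phi> \<inter> cball 0 (sqrt (a / pi)) = {}"
proof (cases "\<Phi> = {}")
  case True
  thus ?thesis using a by simp
next
  case False
  then obtain x where x: "is_closest \<Phi> x" using ex_is_closest[OF fin] by blast
  have "a < void_area \<Phi> \<longleftrightarrow> a / pi < (norm x)\<^sup>2"
    unfolding void_area_def is_closest_infdist[OF x] by (simp add: field_simps)
  also have "\<dots> \<longleftrightarrow> sqrt (a / pi) < norm x"
    using real_less_rsqrt[of "sqrt (a / pi)"] real_sqrt_less_iff[of "a / pi" "(norm x)\<^sup>2"] by simp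
  also have "\<dots> \<longleftrightarrow> \<Phi> \<inter> cball 0 (sqrt (a / pi)) = {}"
    using x by (auto simp: is_closest_def disjoint_iff not_le intro: less_le_trans)
  finally show ?thesis using False by simp
qed

lemma hppp_empty_count_sigma:
  assumes "hppp M N lam"
  shows "{\<omega>\<in>space M. N \<omega> = {}} \<in> count_sigma M N"
proof -
  interpret sigma_algebra "space M" "count_sigma M N" by (rule sigma_algebra_count_sigma)
  have "(\<Union>n. cball 0 (real n)) = (UNIV :: pt set)"
    by (auto intro: real_arch_simple)
  hence "{\<omega>\<in>space M. N \<omega> = {}} = (\<Inter>n. {\<omega>\<in>space M. N \<omega> \<inter> cball 0 (real n) = {}})"
    by blast
  also have "\<dots> \<in> count_sigma M N"
    using hppp_void_count_sigma[OF assms] by (intro countable_INT) auto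
  finally show ?thesis .
qed

text \<open>Emptiness forces every disc to be void, and the void probabilities of growing discs tend
  to 0.\<close>

lemma (in prob_space) hppp_empty_prob:
  assumes N: "hppp M N lam" and lam: "0 < lam"
  shows "prob {\<omega>\<in>space M. N \<omega> = {}} = 0"
proof -
  have "prob {\<omega>\<in>space M. N \<omega> = {}} \<le> exp (- (lam * (pi * (real n)\<^sup>2)))" for n
  proof -
    have "{\<omega>\<in>space M. N \<omega> \<inter> cball 0 (real n) = {}} \<in> events"
      using count_sigma_events[OF N] hppp_void_count_sigma[OF N, of "cball 0 (real n)"] by auto
    hence "prob {\<omega>\<in>space M. N \<omega> = {}} \<le> prob {\<omega>\<in>space M. N \<omega> \<inter> cball 0 (real n) = {}}"
      by (intro finite_measure_mono) auto
    thus ?thesis by (subst (asm) hppp_void_prob[OF N]) (auto simp: content_cball_plane)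
  qed
  moreover have "(\<lambda>n. exp (- (lam * (pi * (real n)\<^sup>2)))) \<longlonglongrightarrow> 0"
  proof (rule filterlim_compose[OF exp_at_bot])
    have "filterlim (\<lambda>n. (lam * pi) * (real n)\<^sup>2) at_top sequentially"
      using lam
      by (intro filterlim_tendsto_pos_mult_at_top[OF tendsto_const] filterlim_pow_at_top filterlim_real_sequentially) auto
    thus "filterlim (\<lambda>n. - (lam * (pi * (real n)\<^sup>2))) at_bot sequentially"
      unfolding filterlim_uminus_at_bot by (simp add: mult.assoc)
  qed
  ultimately have "prob {\<omega>\<in>space M. N \<omega> = {}} \<le> 0"
    by (intro LIMSEQ_le_const) auto
  thus ?thesis by (simp add: measure_le_0_iff)
qed

text \<open>Membership in \<open>count_sigma\<close>, stronger than being an event, is what lets the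
  independence of the processes pass to their void areas.\<close>

lemma hppp_void_area_count_sigma:
  assumes N: "hppp M N lam" and A: "A \<in> sets borel"
  shows "(\<lambda>\<omega>. void_area (N \<omega>)) -` A \<inter> space M \<in> count_sigma M N"
proof -
  interpret sigma_algebra "space M" "count_sigma M N" by (rule sigma_algebra_count_sigma)
  let ?M = "sigma (space M) (count_sigma M N)"
  have sets: "sets ?M = count_sigma M N" by (rule sets_measure_of_eq)
  have "(\<lambda>\<omega>. void_area (N \<omega>)) \<in> borel_measurable ?M"
  proof (rule borel_measurableI_greater)
    fix a :: real
    have "{\<omega>\<in>space M. a < void_area (N \<omega>)} \<in> count_sigma M N"
    proof (cases "a < 0")
      case True
      hence "{\<omega>\<in>space M. a < void_area (N \<omega>)} = space M"
        using void_area_nonneg order_less_le_trans by blast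
      thus ?thesis by simp
    next
      case False
      hence "{\<omega>\<in>space M. a < void_area (N \<omega>)} = {\<omega>\<in>space M. N \<omega> \<inter> cball 0 (sqrt (a / pi)) = {}}
          - {\<omega>\<in>space M. N \<omega> = {}}"
        using less_void_area_iff[OF hppp_finite[OF N, of \<omega> for \<omega>]] by (auto simp: not_less)
      thus ?thesis
        using hppp_empty_count_sigma[OF N] hppp_void_count_sigma[OF N] by auto
    qed
    thus "{\<omega>\<in>space ?M. a < void_area (N \<omega>)} \<in> sets ?M" using sets by simp
  qed
  from measurable_sets[OF this A] show ?thesis using sets by simp
qed

lemma (in prob_space) hppp_void_area_measurable:
  assumes "hppp M N lam"
  shows "(\<lambda>\<omega>. void_area (N \<omega>)) \<in> borel_measurable M"
  using hppp_void_area_count_sigma[OF assms] count_sigma_events[OF assms]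
  by (intro measurableI) auto

lemma (in prob_space) hppp_void_area_tail:
  assumes N: "hppp M N lam" and lam: "0 < lam" and a: "0 \<le> a"
  shows "prob {\<omega>\<in>space M. a < void_area (N \<omega>)} = exp (- (lam * a))"
proof -
  let ?E = "{\<omega>\<in>space M. N \<omega> \<inter> cball 0 (sqrt (a / pi)) = {}}"
  let ?Z = "{\<omega>\<in>space M. N \<omega> = {}}"
  have ev: "?E \<in> events" "?Z \<in> events"
    using count_sigma_events[OF N] hppp_void_count_sigma[OF N] hppp_empty_count_sigma[OF N] by auto
  have "{\<omega>\<in>space M. a < void_area (N \<omega>)} = ?E - ?Z"
    using less_void_area_iff[OF hppp_finite[OF N] a] by auto
  also have "prob \<dots> = prob ?E"
    using ev hppp_empty_prob[OF N lam] by (subst finite_measure_Diff) auto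
  also have "\<dots> = exp (- (lam * a))"
    using a by (subst hppp_void_prob[OF N]) (auto simp: content_cball_plane)
  finally show ?thesis .
qed

lemma (in prob_space) hppp_void_area_exponential:
  assumes N: "hppp M N lam" and lam: "0 < lam"
  shows "distributed M lborel (\<lambda>\<omega>. void_area (N \<omega>)) (exponential_density lam)"
proof (rule exponential_distributedI[OF hppp_void_area_measurable[OF N] lam])
  fix a :: real assume a: "0 \<le> a"
  note [measurable] = hppp_void_area_measurable[OF N]
  have "{\<omega>\<in>space M. void_area (N \<omega>) \<le> a} = space M - {\<omega>\<in>space M. a < void_area (N \<omega>)}"
    by auto
  hence "prob {\<omega>\<in>space M. void_area (N \<omega>) \<le> a} = 1 - exp (- (lam * a))"
    using hppp_void_area_tail[OF N lam a] by (simp add: prob_compl)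
  thus "emeasure M {\<omega>\<in>space M. void_area (N \<omega>) \<le> a} = 1 - ennreal (exp (- a * lam))"
    by (simp add: emeasure_eq_measure mult.commute ennreal_minus flip: ennreal_1)
qed

text \<open>The Laplace transform of an exponential law: the product is \<open>l / (l + k)\<close>
  times the density of rate \<open>l + k\<close>.\<close>

lemma nn_integral_exponential_density_exp:
  assumes "0 < l" "0 < k"
  shows "(\<integral>\<^sup>+y. ennreal (exponential_density l y) * ennreal (exp (- (k * y))) \<partial>lborel) = ennreal (l / (l + k))"
proof -
  interpret D: prob_space "density lborel (exponential_density (l + k))"
    using assms by (intro prob_space_exponential_density) auto
  have "ennreal (exponential_density l y) * ennreal (exp (- (k * y)))
      = ennreal (l / (l + k)) * ennreal (exponential_density (l + k) y)" for y
  proof (cases "y < 0")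
    case False
    have "l * exp (- (y * l)) * exp (- (k * y)) = l * exp (- (y * (l + k)))"
      by (simp add: mult_exp_exp algebra_simps)
    also have "\<dots> = l / (l + k) * ((l + k) * exp (- (y * (l + k))))"
      using assms by simp
    finally show ?thesis
      using False assms by (simp add: exponential_density_def ennreal_mult[symmetric])
  qed (simp add: exponential_density_def)
  moreover have "(\<integral>\<^sup>+y. ennreal (exponential_density (l + k) y) \<partial>lborel) = 1"
    using D.emeasure_space_1 by (simp add: emeasure_density)
  ultimately show ?thesis by (simp add: nn_integral_cmult)
qed

section \<open>Probability that the nearest macro station serves the origin\<close>

text \<open>Given the second area y, the first exceeds c y with probability exp (- l1 c y);
  averaging over y is the Laplace transform at \<open>l1 * c\<close> of an exponential law of rate
  \<open>l2\<close>.\<close>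

lemma (in prob_space) void_area_compare:
  assumes N1: "hppp M N1 l1" and N2: "hppp M N2 l2" and pos: "0 < l1" "0 < l2" "0 < c"
    and ind: "\<And>E1 E2. E1 \<in> count_sigma M N1 \<Longrightarrow> E2 \<in> count_sigma M N2
      \<Longrightarrow> prob (E1 \<inter> E2) = prob E1 * prob E2"
  shows "prob {\<omega>\<in>space M. c * void_area (N2 \<omega>) < void_area (N1 \<omega>)} = l2 / (l2 + l1 * c)"
proof -
  let ?S = "\<lambda>N \<omega>. void_area (N \<omega>)"
  note [measurable] = hppp_void_area_measurable[OF N1] hppp_void_area_measurable[OF N2]
  have sub: "sigma_sets (space M) {?S N -` A \<inter> space M | A. A \<in> sets borel} \<subseteq> count_sigma M N"
    if "hppp M N l" for N l
    using hppp_void_area_count_sigma[OF that]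
    by (intro sigma_algebra.sigma_sets_subset[OF sigma_algebra_count_sigma]) auto
  have iv: "indep_var borel (?S N1) borel (?S N2)"
    unfolding indep_var_eq indep_sets2_eq
  proof (intro conjI ballI)
    show "?S N1 \<in> borel_measurable M" "?S N2 \<in> borel_measurable M" by measurable
    show "sigma_sets (space M) {?S N1 -` A \<inter> space M | A. A \<in> sets borel} \<subseteq> events"
      using sub[OF N1] count_sigma_events[OF N1] by (rule subset_trans)
    show "sigma_sets (space M) {?S N2 -` A \<inter> space M | A. A \<in> sets borel} \<subseteq> events"
      using sub[OF N2] count_sigma_events[OF N2] by (rule subset_trans)
    show "prob (E1 \<inter> E2) = prob E1 * prob E2"
      if "E1 \<in> sigma_sets (space M) {?S N1 -` A \<inter> space M | A. A \<in> sets borel}"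
        "E2 \<in> sigma_sets (space M) {?S N2 -` A \<inter> space M | A. A \<in> sets borel}" for E1 E2
      using that by (intro ind subsetD[OF sub[OF N1]] subsetD[OF sub[OF N2]])
  qed
  let ?D1 = "distr M borel (?S N1)" and ?D2 = "distr M borel (?S N2)"
  interpret D1: prob_space ?D1 by (rule prob_space_distr) simp
  interpret D2: prob_space ?D2 by (rule prob_space_distr) simp
  interpret P: pair_prob_space ?D1 ?D2 ..
  let ?W = "{p :: real \<times> real. c * snd p < fst p}"
  have W [measurable]: "?W \<in> sets (borel \<Otimes>\<^sub>M borel)"
  proof -
    have "{p \<in> space (borel \<Otimes>\<^sub>M borel). c * snd p < fst p} \<in> sets (borel \<Otimes>\<^sub>M borel)"
      by measurable
    thus ?thesis by (simp add: space_pair_measure)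
  qed
  have "emeasure M {\<omega>\<in>space M. c * ?S N2 \<omega> < ?S N1 \<omega>}
      = emeasure (distr M (borel \<Otimes>\<^sub>M borel) (\<lambda>\<omega>. (?S N1 \<omega>, ?S N2 \<omega>))) ?W"
    by (subst emeasure_distr) (auto intro!: arg_cong[where f="emeasure M"])
  also have "\<dots> = emeasure (?D1 \<Otimes>\<^sub>M ?D2) ?W"
    using iv unfolding indep_var_distribution_eq by simp
  also have "\<dots> = (\<integral>\<^sup>+y. emeasure ?D1 ((\<lambda>x. (x, y)) -` ?W) \<partial>?D2)"
    by (rule P.emeasure_pair_measure_alt2) simp
  also have "\<dots> = (\<integral>\<^sup>+\<omega>. emeasure ?D1 {x. c * ?S N2 \<omega> < x} \<partial>M)"
    by (subst nn_integral_distr) (auto simp: vimage_def)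
  also have "\<dots> = (\<integral>\<^sup>+\<omega>. ennreal (exp (- ((l1 * c) * ?S N2 \<omega>))) \<partial>M)"
  proof (rule nn_integral_cong)
    fix \<omega>'
    let ?a = "c * ?S N2 \<omega>'"
    have "emeasure ?D1 {x. ?a < x} = emeasure M {\<omega>\<in>space M. ?a < ?S N1 \<omega>}"
      by (subst emeasure_distr) (auto intro!: arg_cong[where f="emeasure M"])
    also have "\<dots> = ennreal (exp (- (l1 * ?a)))"
      using pos void_area_nonneg by (simp add: emeasure_eq_measure hppp_void_area_tail[OF N1])
    finally show "emeasure ?D1 {x. ?a < x} = ennreal (exp (- ((l1 * c) * ?S N2 \<omega>')))"
      by (simp add: mult.assoc)
  qed
  also have "\<dots> = (\<integral>\<^sup>+y. ennreal (exponential_density l2 y) * ennreal (exp (- ((l1 * c) * y))) \<partial>lborel)"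
    by (rule distributed_nn_integral[OF hppp_void_area_exponential[OF N2 pos(2)], symmetric]) simp
  also have "\<dots> = ennreal (l2 / (l2 + l1 * c))"
    using pos by (intro nn_integral_exponential_density_exp) auto
  finally show ?thesis
    using pos by (simp add: emeasure_eq_measure)
qed

text \<open>Squaring distances turns the condition into a comparison of void areas with factor
  \<open>1 / t\<^sup>2\<close>, and the event is the complement of the strict comparison.\<close>

lemma (in prob_space) nearest_compare:
  fixes t :: real
  assumes N1: "hppp M N1 l1" and N2: "hppp M N2 l2" and pos: "0 < l1" "0 < l2" "0 < t"
    and ind: "\<And>E1 E2. E1 \<in> count_sigma M N1 \<Longrightarrow> E2 \<in> count_sigma M N2
      \<Longrightarrow> prob (E1 \<inter> E2) = prob E1 * prob E2"
  defines "E \<equiv> {\<omega>\<in>space M. \<exists>x. is_closest (N1 \<omega>) x \<and> (\<forall>y\<in>N2 \<omega>. t * norm x \<le> norm y)}"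
  shows "E \<in> events" "prob E = l1 / (l1 + l2 * t\<^sup>2)"
proof -
  note [measurable] = hppp_void_area_measurable[OF N1] hppp_void_area_measurable[OF N2]
  let ?Z = "\<lambda>N. {\<omega>\<in>space M. N \<omega> = {}}"
  let ?L = "{\<omega>\<in>space M. (1 / t\<^sup>2) * void_area (N2 \<omega>) < void_area (N1 \<omega>)}"
  have Z [measurable]: "?Z N1 \<in> events" "?Z N2 \<in> events"
    using hppp_empty_count_sigma[OF N1] hppp_empty_count_sigma[OF N2]
      count_sigma_events[OF N1] count_sigma_events[OF N2] by auto
  \<comment> \<open>An exact description, not one up to null sets, is needed to make
    \<open>E\<close> an event. With no points in \<open>N1\<close> there is no closest one; with
    none in \<open>N2\<close> the condition is vacuous.\<close>
  have mem: "\<omega> \<in> E \<longleftrightarrow> \<omega> \<notin> ?Z N1 \<and> (\<omega> \<in> ?Z N2 \<or> \<omega> \<notin> ?L)" if \<omega>: "\<omega> \<in> space M" for \<omega>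
  proof (cases "N1 \<omega> = {} \<or> N2 \<omega> = {}")
    case True
    thus ?thesis
      using \<omega> ex_is_closest[OF hppp_finite[OF N1 \<omega>]]
      by (cases "N1 \<omega> = {}") (auto simp: E_def is_closest_def[of "{}"])
  next
    case False
    then obtain x y where x: "is_closest (N1 \<omega>) x" and y: "is_closest (N2 \<omega>) y"
      using ex_is_closest[OF hppp_finite[OF N1 \<omega>]] ex_is_closest[OF hppp_finite[OF N2 \<omega>]] by blast
    have "\<omega> \<in> E \<longleftrightarrow> t * norm x \<le> norm y"
    proof
      assume "\<omega> \<in> E"
      then obtain x' where x': "is_closest (N1 \<omega>) x'" "\<forall>y\<in>N2 \<omega>. t * norm x' \<le> norm y"
        by (auto simp: E_def)
      have "norm x' = norm x" using is_closest_infdist[OF x] is_closest_infdist[OF x'(1)] by simp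
      thus "t * norm x \<le> norm y" using x'(2) y by (auto simp: is_closest_def)
    next
      assume "t * norm x \<le> norm y"
      thus "\<omega> \<in> E" using x y \<omega> unfolding E_def is_closest_def by (blast intro: order_trans)
    qed
    also have "\<dots> \<longleftrightarrow> (t * norm x)\<^sup>2 \<le> (norm y)\<^sup>2"
      using pos by (simp add: power_mono_iff)
    also have "\<dots> \<longleftrightarrow> \<omega> \<notin> ?L"
      using pos \<omega> by (simp add: void_area_def is_closest_infdist[OF x] is_closest_infdist[OF y]
          power_mult_distrib field_simps not_less)
    finally show ?thesis using False by simp
  qed
  have E: "E = (space M - ?Z N1) \<inter> (?Z N2 \<union> (space M - ?L))"
  proof (rule set_eqI)
    fix \<omega> show "\<omega> \<in> E \<longleftrightarrow> \<omega> \<in> (space M - ?Z N1) \<inter> (?Z N2 \<union> (space M - ?L))"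
      using mem[of \<omega>] by (cases "\<omega> \<in> space M") (auto simp: E_def)
  qed
  show ev: "E \<in> events" unfolding E by measurable
  have "AE \<omega> in M. \<omega> \<notin> ?Z N" if "?Z N \<in> events" "prob (?Z N) = 0" for N :: "'a \<Rightarrow> pt set"
    using that by (intro AE_not_in) (simp add: null_sets_def emeasure_eq_measure)
  hence "AE \<omega> in M. \<omega> \<notin> ?Z N1 \<and> \<omega> \<notin> ?Z N2"
    using Z hppp_empty_prob[OF N1 pos(1)] hppp_empty_prob[OF N2 pos(2)] by auto
  hence "AE \<omega> in M. \<omega> \<in> E \<longleftrightarrow> \<omega> \<in> space M - ?L"
    using AE_space by eventually_elim (use mem in blast)
  hence "prob E = prob (space M - ?L)"
    using ev by (intro finite_measure_eq_AE) auto
  also have "\<dots> = 1 - l2 / (l2 + l1 * (1 / t\<^sup>2))"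
    using pos void_area_compare[OF N1 N2 _ _ _ ind, of "1 / t\<^sup>2"] by (subst prob_compl) auto
  also have "\<dots> = l1 / (l1 + l2 * t\<^sup>2)"
  proof -
    have "0 < l1 + l2 * t\<^sup>2" using pos by (simp add: add_pos_pos)
    thus ?thesis using pos by (simp add: field_simps)
  qed
  finally show "prob E = l1 / (l1 + l2 * t\<^sup>2)" .
qed

section \<open>Combining the two tiers\<close>

theorem theorem10:
  fixes M :: "'a measure" and Mac Mic U :: "'a \<Rightarrow> pt set"
    and lamBS p Pmac Pmic \<beta> lamSU :: real
  assumes "prob_space M"
    and "lamBS > 0" and "0 < p" and "p < 1" and "Pmac > 0" and "Pmic > 0"
    and "\<beta> > 2" and "lamSU > 0"
    and "hppp M Mac (p * lamBS)" and "hppp M Mic ((1 - p) * lamBS)" and "hppp M U lamSU"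
    and "prob_space.indep_sets M (\<lambda>i. count_sigma M ([Mac, Mic, U] ! i)) {0, 1, 2}"
  shows
    "(let A = {\<omega>\<in>space M. \<exists>x. is_closest (Mac \<omega>) x \<and>
                 0 \<in> het_cell \<beta> (stations Pmac Pmic (Mac \<omega>) (Mic \<omega>)) x Pmac};
          E_mac = (\<integral>\<^sup>+\<omega>. ennreal (real (card (U \<omega> \<inter>
                     het_cell \<beta> (stations Pmac Pmic (insert 0 (Mac \<omega>)) (Mic \<omega>)) 0 Pmac))) \<partial>M);
          E_mic = (\<integral>\<^sup>+\<omega>. ennreal (real (card (U \<omega> \<inter>
                     het_cell \<beta> (stations Pmac Pmic (Mac \<omega>) (insert 0 (Mic \<omega>))) 0 Pmic))) \<partial>M);
          a = p * Pmac powr (2 / \<beta>); b = (1 - p) * Pmic powr (2 / \<beta>)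
      in 1 + ennreal (measure M A) * E_mac + ennreal (measure M (space M - A)) * E_mic
         = ennreal (1 + (a / (a + b))\<^sup>2 * (lamSU / (lamBS * p))
                      + (b / (a + b))\<^sup>2 * (lamSU / (lamBS * (1 - p)))))"
proof -
  interpret prob_space M by fact
  note pos = assms(2-8)
  note mac = assms(9) and mic = assms(10) and usr = assms(11) and ind = assms(12)
  have \<beta>: "0 < \<beta>" using pos by simp
  have rates: "0 < p * lamBS" "0 < (1 - p) * lamBS" using pos by auto
  have ind3: "prob (E1 \<inter> E2 \<inter> E3) = prob E1 * prob E2 * prob E3"
    if E: "E1 \<in> count_sigma M Mac" "E2 \<in> count_sigma M Mic" "E3 \<in> count_sigma M U" for E1 E2 E3
    using indep_setsD[OF ind, of "{0, 1, 2}" "\<lambda>i. [E1, E2, E3] ! i"] E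
    by (simp add: Int_assoc mult.assoc)
  have ind2: "prob (E1 \<inter> E2) = prob E1 * prob E2"
    if E: "E1 \<in> count_sigma M Mac" "E2 \<in> count_sigma M Mic" for E1 E2
    \<comment> \<open>The third list entry is a placeholder, since index 2 lies outside
      \<open>{0, 1}\<close>.\<close>
    using indep_setsD[OF ind, of "{0, 1}" "\<lambda>i. [E1, E2, {}] ! i"] E by simp
  have ind3': "prob (E2 \<inter> E1 \<inter> E3) = prob E2 * prob E1 * prob E3"
    if E: "E2 \<in> count_sigma M Mic" "E1 \<in> count_sigma M Mac" "E3 \<in> count_sigma M U" for E1 E2 E3
    using ind3[OF E(2,1,3)] by (simp add: Int_commute mult.commute)

  define a where "a = p * Pmac powr (2 / \<beta>)"
  define b where "b = (1 - p) * Pmic powr (2 / \<beta>)"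
  define t where "t = (Pmic / Pmac) powr (1 / \<beta>)"
  define A where "A = {\<omega>\<in>space M. \<exists>x. is_closest (Mac \<omega>) x \<and>
    0 \<in> het_cell \<beta> (stations Pmac Pmic (Mac \<omega>) (Mic \<omega>)) x Pmac}"
  have ab: "0 < a" "0 < b" using pos by (auto simp: a_def b_def)
  have "t\<^sup>2 = (Pmic / Pmac) powr (2 / \<beta>)"
    using pos by (simp add: t_def powr_power)
  hence t: "0 < t" "t\<^sup>2 = Pmic powr (2 / \<beta>) / Pmac powr (2 / \<beta>)"
    using pos by (auto simp: t_def powr_divide)

  have "A = {\<omega>\<in>space M. \<exists>x. is_closest (Mac \<omega>) x \<and> (\<forall>y\<in>Mic \<omega>. t * norm x \<le> norm y)}"
    unfolding A_def t_def using origin_mem_het_cell_iff[OF pos(4,5) \<beta>] by blast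
  with nearest_compare[OF mac mic rates t(1) ind2]
  have A: "A \<in> events" "prob A = p * lamBS / (p * lamBS + (1 - p) * lamBS * t\<^sup>2)"
    by simp_all
  \<comment> \<open>Factoring out the own power makes the rate symmetric in the tiers, so both
    denominators become \<open>a + b\<close>.\<close>
  have rate_mac: "p * lamBS + (1 - p) * lamBS * (Pmic powr (2 / \<beta>) / Pmac powr (2 / \<beta>))
      = lamBS / Pmac powr (2 / \<beta>) * (a + b)"
    using pos by (simp add: a_def b_def field_simps)
  have rate_mic: "(1 - p) * lamBS + p * lamBS * (Pmac powr (2 / \<beta>) / Pmic powr (2 / \<beta>))
      = lamBS / Pmic powr (2 / \<beta>) * (a + b)"
    using pos by (simp add: a_def b_def field_simps)
  \<comment> \<open>Here \<open>q\<close> is the tier's share of stations and \<open>u\<close> its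
    power raised to \<open>2 / \<beta>\<close>, so \<open>q * u\<close> is \<open>a\<close> or
    \<open>b\<close>.\<close>
  have mean: "lamSU / (lamBS / u * (a + b)) = q * u / (a + b) * (lamSU / (lamBS * q))"
    if "0 < u" "0 < q" for u q
    using that pos ab by (simp add: field_simps)
  have prob_A: "prob A = a / (a + b)"
  proof -
    have "prob A = p * Pmac powr (2 / \<beta>) / (a + b)"
      unfolding A(2) t(2) rate_mac using pos by simp
    thus ?thesis by (simp only: a_def)
  qed
  hence prob_A': "prob (space M - A) = b / (a + b)"
    using A(1) ab by (simp add: prob_compl field_simps)

  have "(\<integral>\<^sup>+\<omega>. ennreal (real (card (U \<omega> \<inter>
        het_cell \<beta> (stations Pmac Pmic (insert 0 (Mac \<omega>)) (Mic \<omega>)) 0 Pmac))) \<partial>M)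
      = ennreal (lamSU / (p * lamBS + (1 - p) * lamBS * (Pmic / Pmac) powr (2 / \<beta>)))"
    using pos rates by (intro mean_cell_count mac mic usr ind3) auto
  also have "lamSU / (p * lamBS + (1 - p) * lamBS * (Pmic / Pmac) powr (2 / \<beta>))
      = a / (a + b) * (lamSU / (lamBS * p))"
    using mean[of "Pmac powr (2 / \<beta>)" p] pos by (simp only: powr_divide rate_mac) (simp add: a_def)
  finally have E_mac: "(\<integral>\<^sup>+\<omega>. ennreal (real (card (U \<omega> \<inter>
        het_cell \<beta> (stations Pmac Pmic (insert 0 (Mac \<omega>)) (Mic \<omega>)) 0 Pmac))) \<partial>M)
      = ennreal (a / (a + b) * (lamSU / (lamBS * p)))" .

  \<comment> \<open>Exchanging the tiers reduces the micro case to the same mean count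
    lemma.\<close>
  have swap: "stations Pmac Pmic X Y = stations Pmic Pmac Y X" for X Y
    by (simp add: stations_def Un_commute)
  have "(\<integral>\<^sup>+\<omega>. ennreal (real (card (U \<omega> \<inter>
        het_cell \<beta> (stations Pmac Pmic (Mac \<omega>) (insert 0 (Mic \<omega>))) 0 Pmic))) \<partial>M)
      = ennreal (lamSU / ((1 - p) * lamBS + p * lamBS * (Pmac / Pmic) powr (2 / \<beta>)))"
    unfolding swap using pos rates by (intro mean_cell_count mac mic usr ind3') auto
  also have "lamSU / ((1 - p) * lamBS + p * lamBS * (Pmac / Pmic) powr (2 / \<beta>))
      = b / (a + b) * (lamSU / (lamBS * (1 - p)))"
    using mean[of "Pmic powr (2 / \<beta>)" "1 - p"] pos by (simp only: powr_divide rate_mic) (simp add: b_def)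
  finally have E_mic: "(\<integral>\<^sup>+\<omega>. ennreal (real (card (U \<omega> \<inter>
        het_cell \<beta> (stations Pmac Pmic (Mac \<omega>) (insert 0 (Mic \<omega>))) 0 Pmic))) \<partial>M)
      = ennreal (b / (a + b) * (lamSU / (lamBS * (1 - p))))" .

  define m1 where "m1 = lamSU / (lamBS * p)"
  define m2 where "m2 = lamSU / (lamBS * (1 - p))"
  have m: "0 \<le> m1" "0 \<le> m2" using pos by (auto simp: m1_def m2_def)
  \<comment> \<open>The serving probability meets the same fraction inside the mean count, which
    produces the squares.\<close>
  have "1 + ennreal (a / (a + b)) * ennreal (a / (a + b) * m1)
        + ennreal (b / (a + b)) * ennreal (b / (a + b) * m2)
      = ennreal (1 + (a / (a + b))\<^sup>2 * m1 + (b / (a + b))\<^sup>2 * m2)"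
    using ab m by (simp add: ennreal_mult[symmetric] ennreal_plus power2_eq_square mult.assoc flip: ennreal_1)
  thus ?thesis
    unfolding Let_def E_mac E_mic A_def[symmetric] prob_A prob_A' a_def[symmetric] b_def[symmetric]
      m1_def m2_def .
qed

end
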